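(* Let $S=\{1,\dots,n\}$ be equipped with the discrete metric ($\mathrm{dist}(r,s)=1$ if $r\neq s$ and $\mathrm{dist}(r,r)=0$). Let $p,q\in\mathbb{R}^n$ be probability vectors and $Q\in\mathbb{R}^{n\times n}$ a generator matrix. Then $$\frac{\mathrm d}{\mathrm du}\Big|_{u=0^+}\mathrm{W}_1\big(p^{\mathsf T}e^{uQ},q^{\mathsf T}e^{uQ}\big)\le 0 .$$
   Context: A generator matrix is a real square matrix with non-negative off-diagonal entries and all rows summing to $0$. For probability vectors $p,q$ on $S$, $\mathrm{W}_1(p,q)=\min_{\gamma}\sum_{r,s\in S}\mathrm{dist}(r,s)\gamma(r,s)$, the minimum being over all couplings $\gamma$ of $p$ and $q$ (probability measures on $S\times S$ with marginals $p$ and $q$). $\frac{\mathrm d}{\mathrm du}|_{u=0^+}$ denotes the right derivative at $u=0$. *)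

theory Defs
  imports "HOL-Analysis.Analysis"
begin

definition generator_matrix :: "real ^ 'n ^ 'n \<Rightarrow> bool" where
  "generator_matrix Q \<longleftrightarrow>
     (\<forall>i j. i \<noteq> j \<longrightarrow> 0 \<le> Q $ i $ j) \<and> (\<forall>i. (\<Sum>j\<in>UNIV. Q $ i $ j) = 0)"

(* The componentwise product on type vec is not the matrix product, so powers and the
   exponential of a matrix cannot be taken from the classes power and real_normed_algebra_1. *)
primrec matrix_power :: "real ^ 'n ^ 'n \<Rightarrow> nat \<Rightarrow> real ^ 'n ^ 'n" where
  "matrix_power A 0 = mat 1"
| "matrix_power A (Suc k) = A ** matrix_power A k"

definition matrix_exp :: "real ^ 'n ^ 'n \<Rightarrow> real ^ 'n ^ 'n" where
  "matrix_exp A = (\<Sum>k. matrix_power A k /\<^sub>R fact k)"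

definition prob_vector :: "real ^ 'n \<Rightarrow> bool" where
  "prob_vector p \<longleftrightarrow> (\<forall>i. 0 \<le> p $ i) \<and> (\<Sum>i\<in>UNIV. p $ i) = 1"

definition couplings :: "real ^ 'n \<Rightarrow> real ^ 'n \<Rightarrow> (real ^ ('n \<times> 'n)) set" where
  "couplings p q = {\<gamma>. prob_vector \<gamma> \<and>
     (\<forall>r. (\<Sum>s\<in>UNIV. \<gamma> $ (r, s)) = p $ r) \<and>
     (\<forall>s. (\<Sum>r\<in>UNIV. \<gamma> $ (r, s)) = q $ s)}"

definition transport_cost :: "('n \<Rightarrow> 'n \<Rightarrow> real) \<Rightarrow> real ^ ('n::finite \<times> 'n) \<Rightarrow> real" where
  "transport_cost d \<gamma> = (\<Sum>r\<in>UNIV. \<Sum>s\<in>UNIV. d r s * \<gamma> $ (r, s))"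

(* For probability vectors the infimum is a minimum: see W1_attained below. *)
definition W1 :: "('n \<Rightarrow> 'n \<Rightarrow> real) \<Rightarrow> real ^ 'n \<Rightarrow> real ^ 'n \<Rightarrow> real" where
  "W1 d p q = (INF \<gamma>\<in>couplings p q. transport_cost d \<gamma>)"

lemma product_coupling:
  assumes "prob_vector p" "prob_vector q"
  shows "(\<chi> x. p $ fst x * q $ snd x) \<in> couplings p q"
proof -
  have "(\<Sum>x\<in>UNIV. p $ fst x * q $ snd x) = (\<Sum>r\<in>UNIV. \<Sum>s\<in>UNIV. p $ r * q $ s)"
    by (simp add: sum.cartesian_product case_prod_unfold)
  also have "\<dots> = 1"
    using assms unfolding sum_product[symmetric] by (simp add: prob_vector_def)
  finally show ?thesis
    using assms unfolding couplings_def prob_vector_def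
    by (simp flip: sum_distrib_left sum_distrib_right)
qed

lemma compact_couplings: "compact (couplings p q)"
proof -
  have "norm \<gamma> \<le> 1" if "\<gamma> \<in> couplings p q" for \<gamma>
  proof -
    have "(\<Sum>i\<in>UNIV. \<bar>\<gamma> $ i\<bar>) = 1"
      using that unfolding couplings_def prob_vector_def by (simp del: split_paired_All)
    then show ?thesis
      using norm_le_l1_cart[of \<gamma>] by simp
  qed
  then have "bounded (couplings p q)"
    by (auto simp: bounded_iff)
  moreover have "closed (couplings p q)"
    unfolding couplings_def prob_vector_def
    by (intro closed_Collect_conj closed_Collect_all closed_Collect_le closed_Collect_eq
        continuous_intros)
  ultimately show ?thesis
    by (simp add: compact_eq_bounded_closed)
qed

lemma W1_attained:
  assumes "prob_vector p" "prob_vector q"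
  obtains \<gamma> where "\<gamma> \<in> couplings p q" "W1 d p q = transport_cost d \<gamma>"
    "\<And>\<gamma>'. \<gamma>' \<in> couplings p q \<Longrightarrow> transport_cost d \<gamma> \<le> transport_cost d \<gamma>'"
proof -
  have "continuous_on (couplings p q) (transport_cost d)"
    unfolding transport_cost_def by (intro continuous_intros)
  then obtain \<gamma> where \<gamma>: "\<gamma> \<in> couplings p q"
    "\<forall>\<gamma>'\<in>couplings p q. transport_cost d \<gamma> \<le> transport_cost d \<gamma>'"
    using continuous_attains_inf[OF compact_couplings] product_coupling[OF assms] by blast
  moreover have "W1 d p q = transport_cost d \<gamma>"
    unfolding W1_def using \<gamma> by (intro cInf_eq_minimum) auto
  ultimately show ?thesis
    using that by blast
qed

lemma abs_matrix_power_le: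
  "\<bar>matrix_power A k $ i $ j\<bar> \<le> (\<Sum>i\<in>UNIV. \<Sum>j\<in>UNIV. \<bar>A $ i $ j\<bar>) ^ k"
proof (induction k arbitrary: i j)
  case 0
  then show ?case by (simp add: mat_def)
next
  case (Suc k)
  let ?C = "\<Sum>i\<in>UNIV. \<Sum>j\<in>UNIV. \<bar>A $ i $ j\<bar>"
  have "\<bar>matrix_power A (Suc k) $ i $ j\<bar> \<le> (\<Sum>l\<in>UNIV. \<bar>A $ i $ l * matrix_power A k $ l $ j\<bar>)"
    by (simp add: matrix_matrix_mult_def)
  also have "\<dots> \<le> (\<Sum>l\<in>UNIV. \<bar>A $ i $ l\<bar> * ?C ^ k)"
    using Suc.IH by (intro sum_mono) (simp add: abs_mult mult_left_mono)
  also have "\<dots> = (\<Sum>l\<in>UNIV. \<bar>A $ i $ l\<bar>) * ?C ^ k"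
    by (simp add: sum_distrib_right)
  also have "\<dots> \<le> ?C * ?C ^ k"
    by (intro mult_right_mono member_le_sum[where f = "\<lambda>i. \<Sum>l\<in>UNIV. \<bar>A $ i $ l\<bar>"])
      (simp_all add: sum_nonneg)
  finally show ?case by simp
qed

lemma summable_matrix_exp: "summable (\<lambda>k. matrix_power A k /\<^sub>R fact k)"
  for A :: "real ^ 'n ^ 'n"
proof -
  let ?C = "\<Sum>i\<in>UNIV. \<Sum>j\<in>UNIV. \<bar>A $ i $ j\<bar>"
  let ?N = "real CARD('n)"
  have bound: "norm (matrix_power A k /\<^sub>R fact k) \<le> ?N * (?N * (?C ^ k /\<^sub>R fact k))" for k
  proof -
    have "norm (matrix_power A k) \<le> (\<Sum>i\<in>UNIV. norm (matrix_power A k $ i))"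
      unfolding norm_vec_def by (rule L2_set_le_sum) simp
    also have "\<dots> \<le> (\<Sum>i\<in>(UNIV::'n set). \<Sum>j\<in>(UNIV::'n set). ?C ^ k)"
      by (intro sum_mono order_trans[OF norm_le_l1_cart] abs_matrix_power_le)
    finally have "norm (matrix_power A k) \<le> ?N * (?N * ?C ^ k)" by simp
    then show ?thesis by (simp add: field_simps)
  qed
  have "summable (\<lambda>k. ?N * (?N * (?C ^ k /\<^sub>R fact k)))"
    by (intro summable_mult summable_exp_generic)
  then show ?thesis
    using bound by (rule summable_comparison_test')
qed

end

theory Submission
  imports Defs
begin

text \<open>
  For the discrete metric, \<open>W1 p q\<close> is the total variation distance, half the \<open>\<ell>\<^sup>1\<close> norm of
  \<open>p - q\<close>: the optimal coupling leaves the common mass \<open>min p q\<close> in place and distributes the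
  excess of \<open>p\<close> over that of \<open>q\<close> as a product.  The matrix \<open>e\<^bsup>uQ\<^esup>\<close> is stochastic for \<open>u \<ge> 0\<close>, since
  \<open>Q + cI\<close> is entrywise non-negative for large \<open>c\<close> and \<open>e\<^bsup>Q + cI\<^esup> = e\<^bsup>c\<^esup> e\<^bsup>Q\<^esup>\<close>; so it
  contracts the \<open>\<ell>\<^sup>1\<close> norm.  Each coordinate of \<open>(p - q)\<^sup>T e\<^bsup>uQ\<^esup>\<close> is a power series in \<open>u\<close>, hence
  its absolute value has a right derivative at \<open>0\<close>, and by the contraction the sum of these
  derivatives is not positive.
\<close>

section \<open>Entrywise series for the matrix exponential and shifts by scalar matrices\<close>

lemma matrix_exp_sums:
  "(\<lambda>k. matrix_power A k $ i $ j / fact k) sums (matrix_exp A $ i $ j)"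
proof -
  have "(\<lambda>k. (matrix_power A k /\<^sub>R fact k) $ i $ j) sums (matrix_exp A $ i $ j)"
    unfolding matrix_exp_def
    by (intro bounded_linear.sums[OF bounded_linear_vec_nth] summable_sums summable_matrix_exp)
  then show ?thesis
    by (simp add: field_simps)
qed

text \<open>Absolute convergence is what the Cauchy product in \<open>matrix_exp_add_scalar\<close>
  requires.\<close>

lemma summable_abs_matrix_exp:
  "summable (\<lambda>k. \<bar>matrix_power A k $ i $ j / fact k\<bar>)"
proof (rule summable_comparison_test')
  let ?C = "\<Sum>i\<in>UNIV. \<Sum>j\<in>UNIV. \<bar>A $ i $ j\<bar>"
  show "summable (\<lambda>k. ?C ^ k /\<^sub>R fact k)"
    by (rule summable_exp_generic)
  show "norm \<bar>matrix_power A k $ i $ j / fact k\<bar> \<le> ?C ^ k /\<^sub>R fact k" for k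
    using abs_matrix_power_le[of A k i j] by (simp add: field_simps)
qed

lemma matrix_power_scaleR:
  "matrix_power (u *\<^sub>R A) k = u ^ k *\<^sub>R matrix_power A k"
  by (induction k) (simp_all add: matrix_matrix_mult_def vec_eq_iff sum_distrib_left mult_ac)

lemma matrix_power_nonneg:
  assumes "\<And>i j. 0 \<le> A $ i $ j"
  shows "0 \<le> matrix_power A k $ i $ j"
  using assms by (induction k arbitrary: i j)
    (auto simp: mat_def matrix_matrix_mult_def intro!: sum_nonneg)

text \<open>Binomial theorem, valid because a scalar matrix commutes with \<open>A\<close>. After
  division by \<open>fact k\<close> the right side is the \<open>k\<close>-th coefficient of the
  Cauchy product of the series for an entry of the exponential of \<open>A\<close> and for
  \<open>exp c\<close>.\<close>

lemma matrix_power_add_scalar: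
  fixes A :: "real ^ 'n ^ 'n"
  shows "matrix_power (A + mat c) k $ i $ j / fact k =
    (\<Sum>l\<le>k. matrix_power A l $ i $ j / fact l * (c ^ (k - l) / fact (k - l)))"
proof -
  define P where "P l i j = matrix_power A l $ i $ j" for l i j
  have row: "(\<Sum>m\<in>UNIV. (A + mat c) $ i $ m * g m) = (\<Sum>m\<in>UNIV. A $ i $ m * g m) + c * g i"
    for g i
    by (simp add: mat_def distrib_right sum.distrib if_distrib[of "\<lambda>x. x * _"] cong: if_cong)
  have "matrix_power (A + mat c) k $ i $ j = (\<Sum>l\<le>k. of_nat (k choose l) * P l i j * c ^ (k - l))" for i j
  proof (induction k arbitrary: i j)
    case 0
    then show ?case by (simp add: P_def)
  next
    case (Suc k)
    have PS: "(\<Sum>m\<in>UNIV. A $ i $ m * P l m j) = P (Suc l) i j" for l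
      by (simp add: P_def matrix_matrix_mult_def)
    have "matrix_power (A + mat c) (Suc k) $ i $ j =
        (\<Sum>m\<in>UNIV. A $ i $ m * (\<Sum>l\<le>k. of_nat (k choose l) * P l m j * c ^ (k - l)))
        + c * (\<Sum>l\<le>k. of_nat (k choose l) * P l i j * c ^ (k - l))" (is "_ = ?X + ?Y")
      by (simp only: matrix_power.simps matrix_matrix_mult_def vec_lambda_beta Suc.IH row)
    moreover have "?X = (\<Sum>l\<le>k. of_nat (k choose l) * P (Suc l) i j * c ^ (k - l))"
    proof -
      have "?X = (\<Sum>l\<le>k. of_nat (k choose l) * c ^ (k - l) * (\<Sum>m\<in>UNIV. A $ i $ m * P l m j))"
        unfolding sum_distrib_left by (subst sum.swap) (simp add: mult_ac)
      also have "\<dots> = (\<Sum>l\<le>k. of_nat (k choose l) * P (Suc l) i j * c ^ (k - l))"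
        unfolding PS by (simp add: mult_ac)
      finally show ?thesis .
    qed
    moreover have "?Y = P 0 i j * c ^ Suc k
        + (\<Sum>l\<le>k. of_nat (k choose Suc l) * P (Suc l) i j * c ^ (k - l))"
    proof -
      have "?Y = (\<Sum>l\<le>k. of_nat (k choose l) * P l i j * c ^ (Suc k - l))"
        by (simp add: sum_distrib_left mult_ac Suc_diff_le)
      \<comment> \<open>The new term \<open>l = Suc k\<close> vanishes since
        \<open>k choose Suc k\<close> is 0; the longer range lets the term \<open>l = 0\<close> be
        split off by an index shift.\<close>
      also have "\<dots> = (\<Sum>l\<le>Suc k. of_nat (k choose l) * P l i j * c ^ (Suc k - l))"
        by simp
      also have "\<dots> = P 0 i j * c ^ Suc k
          + (\<Sum>l\<le>k. of_nat (k choose Suc l) * P (Suc l) i j * c ^ (k - l))"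
        by (subst sum.atMost_Suc_shift) simp
      finally show ?thesis .
    qed
    \<comment> \<open>Pascal's rule splits \<open>Suc k choose Suc l\<close> into the coefficients
      found in \<open>?X\<close> and \<open>?Y\<close>.\<close>
    moreover have "(\<Sum>l\<le>Suc k. of_nat (Suc k choose l) * P l i j * c ^ (Suc k - l))
        = P 0 i j * c ^ Suc k + ((\<Sum>l\<le>k. of_nat (k choose l) * P (Suc l) i j * c ^ (k - l))
        + (\<Sum>l\<le>k. of_nat (k choose Suc l) * P (Suc l) i j * c ^ (k - l)))"
      by (subst sum.atMost_Suc_shift) (simp add: distrib_right sum.distrib)
    ultimately show ?case
      by linarith
  qed
  then show ?thesis
    by (simp add: P_def sum_divide_distrib binomial_fact)
qed

lemma matrix_exp_add_scalar:
  "matrix_exp (A + mat c) $ i $ j = matrix_exp A $ i $ j * exp c"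
proof -
  have "(\<lambda>k. \<Sum>l\<le>k. matrix_power A l $ i $ j / fact l * (c ^ (k - l) / fact (k - l))) sums
      ((\<Sum>k. matrix_power A k $ i $ j / fact k) * (\<Sum>k. c ^ k / fact k))"
    using summable_abs_matrix_exp[of A i j] summable_norm_exp[of c]
    by (intro Cauchy_product_sums) (simp_all add: divide_inverse mult_ac)
  also have "(\<Sum>k. matrix_power A k $ i $ j / fact k) = matrix_exp A $ i $ j"
    using matrix_exp_sums by (rule sums_unique[symmetric])
  also have "(\<Sum>k. c ^ k / fact k) = exp c"
    by (simp add: exp_def divide_inverse mult_ac)
  finally show ?thesis
    using matrix_exp_sums[of "A + mat c" i j] sums_unique2 by (simp add: matrix_power_add_scalar)
qed

section \<open>Exponentials of generators are stochastic matrices\<close>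

lemma matrix_exp_generator_nonneg:
  fixes Q :: "real ^ 'n ^ 'n"
  assumes "generator_matrix Q"
  shows "0 \<le> matrix_exp Q $ i $ j"
proof -
  \<comment> \<open>A shift that dominates every diagonal entry at once, so all powers of
    \<open>Q + mat c\<close> are non-negative; the shift only costs the positive factor
    \<open>exp c\<close>.\<close>
  define c where "c = (\<Sum>i\<in>UNIV. \<bar>Q $ i $ i\<bar>)"
  have "\<bar>Q $ i $ i\<bar> \<le> c" for i
    unfolding c_def by (rule member_le_sum) auto
  then have "0 \<le> Q $ i $ i + c" for i
    using abs_ge_minus_self[of "Q $ i $ i"] by (metis add.commute diff_ge_0_iff_ge diff_minus_eq_add order_trans uminus_add_conv_diff)
  then have "0 \<le> (Q + mat c) $ i $ j" for i j
    using assms by (cases "i = j") (simp_all add: generator_matrix_def mat_def)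
  then have "0 \<le> matrix_exp (Q + mat c) $ i $ j"
    by (intro sums_le[OF _ sums_zero matrix_exp_sums]) (simp add: matrix_power_nonneg)
  then show ?thesis
    by (simp add: matrix_exp_add_scalar zero_le_mult_iff)
qed

lemma matrix_exp_generator_row_sum:
  fixes Q :: "real ^ 'n ^ 'n"
  assumes "generator_matrix Q"
  shows "(\<Sum>j\<in>UNIV. matrix_exp Q $ i $ j) = 1"
proof -
  \<comment> \<open>\<open>Q\<close> annihilates the all-ones vector, hence so does every positive
    power, and only the term \<open>k = 0\<close> of the series contributes to a row sum.\<close>
  have pow: "(\<Sum>j\<in>UNIV. matrix_power Q k $ i $ j) = (if k = 0 then 1 else 0)" for k i
  proof (induction k arbitrary: i)
    case 0
    then show ?case by (simp add: mat_def)
  next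
    case (Suc k)
    have "(\<Sum>j\<in>UNIV. matrix_power Q (Suc k) $ i $ j)
        = (\<Sum>l\<in>UNIV. Q $ i $ l * (\<Sum>j\<in>UNIV. matrix_power Q k $ l $ j))"
      unfolding sum_distrib_left by (subst sum.swap) (simp add: matrix_matrix_mult_def)
    also have "\<dots> = 0"
      using assms by (simp add: Suc.IH generator_matrix_def)
    finally show ?case by simp
  qed
  have "(\<lambda>k. \<Sum>j\<in>UNIV. matrix_power Q k $ i $ j / fact k) sums (\<Sum>j\<in>UNIV. matrix_exp Q $ i $ j)"
    by (intro sums_sum matrix_exp_sums)
  moreover have "(\<lambda>k. \<Sum>j\<in>UNIV. matrix_power Q k $ i $ j / fact k) = (\<lambda>k. if k = 0 then 1 else 0)"
    by (auto simp: pow simp flip: sum_divide_distrib)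
  ultimately show ?thesis
    using sums_single[of 0 "\<lambda>_. 1::real"] sums_unique2 by metis
qed

text \<open>As a function of \<open>u\<close> the entry is a power series that converges everywhere,
  so it can be differentiated termwise.\<close>

lemma matrix_exp_has_derivative:
  "\<exists>D. ((\<lambda>u. matrix_exp (u *\<^sub>R A) $ i $ j) has_real_derivative D) (at x)"
proof -
  have eq: "(\<lambda>k. matrix_power A k $ i $ j / fact k * u ^ k) sums (matrix_exp (u *\<^sub>R A) $ i $ j)" for u
    using matrix_exp_sums[of "u *\<^sub>R A" i j] by (simp add: matrix_power_scaleR mult_ac)
  have "((\<lambda>u. \<Sum>k. matrix_power A k $ i $ j / fact k * u ^ k) has_real_derivative
      (\<Sum>k. diffs (\<lambda>k. matrix_power A k $ i $ j / fact k) k * x ^ k)) (at x)"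
    using eq by (intro termdiffs_strong_converges_everywhere) (rule sums_summable)
  also have "(\<lambda>u. \<Sum>k. matrix_power A k $ i $ j / fact k * u ^ k) = (\<lambda>u. matrix_exp (u *\<^sub>R A) $ i $ j)"
    using eq by (intro ext) (rule sums_unique[symmetric])
  finally show ?thesis ..
qed

lemma matrix_exp_zero: "matrix_exp 0 = (mat 1 :: real ^ 'n ^ 'n)"
proof -
  have "matrix_power (0 :: real ^ 'n ^ 'n) k = (if k = 0 then mat 1 else 0)" for k
    by (induction k) (auto simp: matrix_matrix_mult_def vec_eq_iff)
  then have "(\<lambda>k. matrix_power (0 :: real ^ 'n ^ 'n) k /\<^sub>R fact k) = (\<lambda>k. if k = 0 then mat 1 else 0)"
    by auto
  then show ?thesis
    using sums_single[of 0 "\<lambda>_. mat 1 :: real ^ 'n ^ 'n"] by (simp add: matrix_exp_def sums_unique[symmetric])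
qed

section \<open>Stochastic matrices acting on row vectors\<close>

lemma prob_vector_vector_matrix_mult:
  fixes M :: "real ^ 'n ^ 'n"
  assumes "prob_vector p" "\<And>i j. 0 \<le> M $ i $ j" "\<And>i. (\<Sum>j\<in>UNIV. M $ i $ j) = 1"
  shows "prob_vector (p v* M)"
proof -
  have "(\<Sum>j\<in>UNIV. (p v* M) $ j) = (\<Sum>i\<in>UNIV. p $ i * (\<Sum>j\<in>UNIV. M $ i $ j))"
    unfolding sum_distrib_left by (subst sum.swap) (simp add: vector_matrix_mult_def mult_ac)
  then show ?thesis
    using assms by (auto simp: prob_vector_def vector_matrix_mult_def intro!: sum_nonneg)
qed

text \<open>Triangle inequality in each coordinate; after exchanging the sums, the row sums 1 absorb
  the matrix.\<close>

lemma l1_vector_matrix_mult_le: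
  fixes M :: "real ^ 'n ^ 'n"
  assumes "\<And>i j. 0 \<le> M $ i $ j" "\<And>i. (\<Sum>j\<in>UNIV. M $ i $ j) = 1"
  shows "(\<Sum>j\<in>UNIV. \<bar>(p v* M) $ j\<bar>) \<le> (\<Sum>i\<in>UNIV. \<bar>p $ i\<bar>)"
proof -
  have "(\<Sum>j\<in>UNIV. \<bar>(p v* M) $ j\<bar>) \<le> (\<Sum>j\<in>UNIV. \<Sum>i\<in>UNIV. \<bar>p $ i\<bar> * M $ i $ j)"
    using assms(1) by (intro sum_mono) (auto simp: vector_matrix_mult_def abs_mult mult_ac intro!: order_trans[OF sum_abs])
  also have "\<dots> = (\<Sum>i\<in>UNIV. \<bar>p $ i\<bar> * (\<Sum>j\<in>UNIV. M $ i $ j))"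
    unfolding sum_distrib_left by (rule sum.swap)
  finally show ?thesis
    by (simp add: assms(2))
qed

section \<open>W1 for the discrete metric as total variation\<close>

lemma transport_cost_discrete:
  fixes \<gamma> :: "real ^ ('n::finite \<times> 'n)"
  assumes "\<gamma> \<in> couplings p q"
  shows "transport_cost discrete_metric.dd \<gamma> = 1 - (\<Sum>r\<in>UNIV. \<gamma> $ (r, r))"
proof -
  have "transport_cost discrete_metric.dd \<gamma>
      = (\<Sum>r\<in>UNIV. \<Sum>s\<in>UNIV. \<gamma> $ (r, s) - (if r = s then \<gamma> $ (r, s) else 0))"
    unfolding transport_cost_def by (intro sum.cong refl) (simp add: discrete_metric.dd_def)
  also have "\<dots> = (\<Sum>x\<in>UNIV. \<gamma> $ x) - (\<Sum>r\<in>UNIV. \<gamma> $ (r, r))"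
    by (simp add: sum_subtractf sum.cartesian_product)
  finally show ?thesis
    using assms by (simp add: couplings_def prob_vector_def)
qed

text \<open>The excesses of \<open>p\<close> and of \<open>q\<close> over their minimum have the
  same total mass \<open>t\<close>, so their product divided by \<open>t\<close> has them as
  marginals and can be added to the common mass on the diagonal.\<close>

lemma optimal_discrete_coupling:
  fixes p q :: "real ^ 'n"
  assumes p: "prob_vector p" and q: "prob_vector q"
  obtains \<gamma> where "\<gamma> \<in> couplings p q" "\<And>r. \<gamma> $ (r, r) = min (p $ r) (q $ r)"
proof -
  define m where "m r = min (p $ r) (q $ r)" for r
  define t where "t = 1 - (\<Sum>r\<in>UNIV. m r)"
  \<comment> \<open>If \<open>t = 0\<close> then \<open>p = q = m\<close>, and the quotient is \<open>0 / 0 = 0\<close>.\<close>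
  define \<gamma> :: "real ^ ('n::finite \<times> 'n)" where
    "\<gamma> = (\<chi> x. (if fst x = snd x then m (fst x) else 0)
      + (p $ fst x - m (fst x)) * (q $ snd x - m (snd x)) / t)"
  have sp: "(\<Sum>r\<in>UNIV. p $ r - m r) = t" and sq: "(\<Sum>r\<in>UNIV. q $ r - m r) = t"
    using p q by (simp_all add: t_def prob_vector_def sum_subtractf)
  have t0: "0 \<le> t"
    unfolding sp[symmetric] by (intro sum_nonneg) (simp add: m_def)
  have ep: "p $ r = m r" if "t = 0" for r
    using sp that by (simp add: sum_nonneg_eq_0_iff m_def)
  have eq: "q $ r = m r" if "t = 0" for r
    using sq that by (simp add: sum_nonneg_eq_0_iff m_def)
  have row: "(\<Sum>s\<in>UNIV. \<gamma> $ (r, s)) = p $ r" for r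
  proof -
    have "(\<Sum>s\<in>UNIV. \<gamma> $ (r, s)) = m r + (p $ r - m r) * (\<Sum>s\<in>UNIV. q $ s - m s) / t"
      by (simp add: \<gamma>_def sum.distrib sum_distrib_left sum_divide_distrib)
    then show ?thesis
      unfolding sq using ep by (cases "t = 0") simp_all
  qed
  have col: "(\<Sum>r\<in>UNIV. \<gamma> $ (r, s)) = q $ s" for s
  proof -
    have "(\<Sum>r\<in>UNIV. \<gamma> $ (r, s)) = m s + (\<Sum>r\<in>UNIV. p $ r - m r) * (q $ s - m s) / t"
      by (simp add: \<gamma>_def sum.distrib sum_distrib_right sum_divide_distrib)
    then show ?thesis
      unfolding sp using eq by (cases "t = 0") simp_all
  qed
  have "(\<Sum>x\<in>UNIV. \<gamma> $ x) = (\<Sum>r\<in>UNIV. \<Sum>s\<in>UNIV. \<gamma> $ (r, s))"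
    by (simp add: sum.cartesian_product)
  also have "\<dots> = 1"
    using p by (simp add: row prob_vector_def)
  finally have total: "(\<Sum>x\<in>UNIV. \<gamma> $ x) = 1" .
  have "0 \<le> m r" "m r \<le> p $ r" "m r \<le> q $ r" for r
    using p q by (simp_all add: m_def prob_vector_def)
  then have "0 \<le> \<gamma> $ x" for x
    using t0 by (simp add: \<gamma>_def)
  then have "\<gamma> \<in> couplings p q"
    using total row col by (simp add: couplings_def prob_vector_def)
  \<comment> \<open>The product term vanishes on the diagonal: at each \<open>r\<close> one of the
    two excesses is 0.\<close>
  moreover have "\<gamma> $ (r, r) = min (p $ r) (q $ r)" for r
    by (simp add: \<gamma>_def m_def min_def)
  ultimately show ?thesis
    using that by blast
qed

text \<open>The cost is one minus the diagonal mass. Each diagonal entry is bounded by its row sum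
  and its column sum, hence by their minimum, and one coupling attains all these bounds together.
  The absolute values enter through \<open>|a - b| = a + b - 2 * min a b\<close>.\<close>

lemma W1_discrete:
  fixes p q :: "real ^ 'n"
  assumes "prob_vector p" "prob_vector q"
  shows "W1 discrete_metric.dd p q = (\<Sum>i\<in>UNIV. \<bar>(p - q) $ i\<bar>) / 2"
proof -
  let ?c = "transport_cost discrete_metric.dd"
  have "(\<Sum>i\<in>UNIV. \<bar>(p - q) $ i\<bar>) = (\<Sum>i\<in>UNIV. p $ i + q $ i - 2 * min (p $ i) (q $ i))"
    by (intro sum.cong refl) (simp add: min_def)
  also have "\<dots> = 2 - 2 * (\<Sum>i\<in>UNIV. min (p $ i) (q $ i))"
    using assms by (simp add: sum_subtractf sum.distrib sum_distrib_left prob_vector_def)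
  finally have l1: "(\<Sum>i\<in>UNIV. \<bar>(p - q) $ i\<bar>) / 2 = 1 - (\<Sum>i\<in>UNIV. min (p $ i) (q $ i))"
    by simp
  obtain \<gamma> where \<gamma>: "\<gamma> \<in> couplings p q" "W1 discrete_metric.dd p q = ?c \<gamma>"
      "\<And>\<gamma>'. \<gamma>' \<in> couplings p q \<Longrightarrow> ?c \<gamma> \<le> ?c \<gamma>'"
    using W1_attained[OF assms] by blast
  obtain \<gamma>' where \<gamma>': "\<gamma>' \<in> couplings p q" "\<And>r. \<gamma>' $ (r, r) = min (p $ r) (q $ r)"
    using optimal_discrete_coupling[OF assms] by blast
  have "\<gamma> $ (r, r) \<le> min (p $ r) (q $ r)" for r
  proof -
    have nn: "0 \<le> \<gamma> $ x" for x
      using \<gamma>(1) by (simp add: couplings_def prob_vector_def del: split_paired_All)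
    have "\<gamma> $ (r, r) \<le> (\<Sum>s\<in>UNIV. \<gamma> $ (r, s))"
      by (rule member_le_sum) (auto simp: nn)
    moreover have "\<gamma> $ (r, r) \<le> (\<Sum>s\<in>UNIV. \<gamma> $ (s, r))"
      by (rule member_le_sum[where f = "\<lambda>s. \<gamma> $ (s, r)"]) (auto simp: nn)
    ultimately show ?thesis
      using \<gamma>(1) by (simp add: couplings_def)
  qed
  then have "1 - (\<Sum>i\<in>UNIV. min (p $ i) (q $ i)) \<le> ?c \<gamma>"
    by (simp add: transport_cost_discrete[OF \<gamma>(1)] sum_mono)
  moreover have "?c \<gamma> \<le> 1 - (\<Sum>i\<in>UNIV. min (p $ i) (q $ i))"
    using \<gamma>(3)[OF \<gamma>'(1)] by (simp add: transport_cost_discrete[OF \<gamma>'(1)] \<gamma>'(2))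
  ultimately show ?thesis
    using \<gamma>(2) l1 by simp
qed

section \<open>Right derivatives and their sign\<close>

lemma abs_has_right_derivative:
  fixes f :: "real \<Rightarrow> real"
  assumes "(f has_real_derivative D) (at_right x)"
  shows "\<exists>D'. ((\<lambda>u. \<bar>f u\<bar>) has_real_derivative D') (at_right x)"
proof (cases "f x = 0")
  case True
  \<comment> \<open>To the right of a zero of \<open>f\<close> the denominator is positive, so the
    quotient of the absolute value is the absolute value of the quotient.\<close>
  have "((\<lambda>u. \<bar>(f u - f x) / (u - x)\<bar>) \<longlongrightarrow> \<bar>D\<bar>) (at_right x)"
    using assms unfolding has_field_derivative_iff by (rule tendsto_rabs)
  moreover have "\<forall>\<^sub>F u in at_right x. \<bar>(f u - f x) / (u - x)\<bar> = (\<bar>f u\<bar> - \<bar>f x\<bar>) / (u - x)"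
    using eventually_at_right_less by eventually_elim (simp add: True)
  ultimately have "((\<lambda>u. \<bar>f u\<bar>) has_real_derivative \<bar>D\<bar>) (at_right x)"
    unfolding has_field_derivative_iff by (rule Lim_transform_eventually)
  then show ?thesis ..
next
  case False
  \<comment> \<open>Away from zeros the absolute value is the root of the square, and the chain rule
    applies.\<close>
  then have "((\<lambda>u. sqrt ((f u)\<^sup>2)) has_real_derivative
      inverse (sqrt ((f x)\<^sup>2)) / 2 * (2 * f x * D)) (at_right x)"
    by (intro DERIV_chain2[OF DERIV_real_sqrt] DERIV_power[OF assms, where n = 2, THEN DERIV_cong]) auto
  then show ?thesis
    unfolding real_sqrt_abs ..
qed

theorem corollary14:
  fixes p q :: "real ^ 'n" and Q :: "real ^ 'n ^ 'n"
  assumes "prob_vector p" and "prob_vector q" and "generator_matrix Q"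
  shows "\<exists>D. ((\<lambda>u. W1 discrete_metric.dd (p v* matrix_exp (u *\<^sub>R Q)) (q v* matrix_exp (u *\<^sub>R Q)))
               has_real_derivative D) (at_right 0) \<and> D \<le> 0"
proof -
  define E where "E u = matrix_exp (u *\<^sub>R Q)" for u
  define f where "f u = (\<Sum>j\<in>UNIV. \<bar>((p - q) v* E u) $ j\<bar>) / 2" for u
  have gen: "generator_matrix (u *\<^sub>R Q)" if "0 \<le> u" for u
    using assms(3) that by (simp add: generator_matrix_def sum_distrib_left[symmetric])
  note E = matrix_exp_generator_nonneg[OF gen, folded E_def]
    matrix_exp_generator_row_sum[OF gen, folded E_def]
  have W1: "W1 discrete_metric.dd (p v* E u) (q v* E u) = f u" if "0 \<le> u" for u
    using assms(1,2) E[OF that]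
    by (simp add: W1_discrete prob_vector_vector_matrix_mult f_def vector_matrix_mult_diff_distrib)
  have f0: "f 0 = (\<Sum>j\<in>UNIV. \<bar>(p - q) $ j\<bar>) / 2"
    by (simp add: f_def E_def matrix_exp_zero)
  have "\<exists>D. ((\<lambda>u. \<bar>((p - q) v* E u) $ j\<bar>) has_real_derivative D) (at_right 0)" for j
  proof -
    have "\<exists>D. ((\<lambda>u. E u $ i $ j) has_real_derivative D) (at_right 0)" for i
      using matrix_exp_has_derivative unfolding E_def by (blast intro: has_field_derivative_at_within)
    then obtain e where "\<And>i. ((\<lambda>u. E u $ i $ j) has_real_derivative e i) (at_right 0)"
      by metis
    then have "((\<lambda>u. \<Sum>i\<in>UNIV. (p - q) $ i * E u $ i $ j) has_real_derivative
        (\<Sum>i\<in>UNIV. (p - q) $ i * e i)) (at_right 0)"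
      by (intro DERIV_sum DERIV_cmult)
    then show ?thesis
      unfolding vector_matrix_mult_def vec_lambda_beta by (rule abs_has_right_derivative)
  qed
  then obtain e where "\<And>j. ((\<lambda>u. \<bar>((p - q) v* E u) $ j\<bar>) has_real_derivative e j) (at_right 0)"
    by metis
  then have f': "(f has_real_derivative (\<Sum>j\<in>UNIV. e j) / 2) (at_right 0)"
    unfolding f_def by (intro DERIV_cdivide DERIV_sum)
  \<comment> \<open>\<open>E 0\<close> is the identity, so contraction compares time
    \<open>u\<close> with time 0. Every right difference quotient at 0 is then at most 0, and so is
    its limit.\<close>
  have "f u \<le> f 0" if "0 \<le> u" for u
    using l1_vector_matrix_mult_le[of "E u" "p - q"] E[OF that] by (simp add: f0) (simp add: f_def)
  then have "\<forall>\<^sub>F u in at_right 0. (f u - f 0) / (u - 0) \<le> 0"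
    using eventually_at_right_less[of 0] by (auto elim!: eventually_mono simp: divide_le_0_iff)
  then have "(\<Sum>j\<in>UNIV. e j) / 2 \<le> 0"
    using f' unfolding has_field_derivative_iff by (intro tendsto_upperbound) auto
  \<comment> \<open>\<open>W1\<close> is identified with \<open>f\<close> only for
    \<open>u \<ge> 0\<close>, where the vectors are known to be probability vectors; a right
    derivative at 0 sees no other points.\<close>
  moreover have "((\<lambda>u. W1 discrete_metric.dd (p v* E u) (q v* E u)) has_real_derivative
      (\<Sum>j\<in>UNIV. e j) / 2) (at_right 0)"
    using f' unfolding has_field_derivative_iff
    by (rule Lim_transform_eventually) (auto simp: W1 intro: eventually_mono[OF eventually_at_right_less])
  ultimately show ?thesis
    unfolding E_def by blast
qed

end
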